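(* For all $k\in\mathbb{N}$ we have $$\overline{\genfrac{[}{]}{0pt}{}{x}{k}}=(-1)^kq^{\binom{k+1}{2}}S^{k-1}\genfrac{[}{]}{0pt}{}{x}{k}=(-1)^k\sum_{i=0}^{k-1}q^{\binom{k+1}{2}+(k-1-i)(k-i)}\genfrac{[}{]}{0pt}{}{k-1}{i}_q\genfrac{[}{]}{0pt}{}{x}{k-i}.$$ In particular the coefficients expressing $\overline{\genfrac{[}{]}{0pt}{}{x}{k}}$ in the basis of the $\genfrac{[}{]}{0pt}{}{x}{i}$ are in $(-1)^k\mathbb{N}[q]$, which means that in fact $\overline{\genfrac{[}{]}{0pt}{}{x}{k}}\in\mathcal{R}_q^{+}$. For all $k\in\mathbb{N}$ we also have $$\genfrac{[}{]}{0pt}{}{x}{k}=(-1)^kq^{-\binom{k+1}{2}}S^{-(k-1)}\overline{\genfrac{[}{]}{0pt}{}{x}{k}}=(-1)^k\sum_{i=0}^{k-1}q^{-\binom{k+1}{2}+(i-k+1)k}\genfrac{[}{]}{0pt}{}{k-1}{i}_q\overline{\genfrac{[}{]}{0pt}{}{x}{k-i}}.$$ In particular the coefficients expressing $\genfrac{[}{]}{0pt}{}{x}{k}$ in the basis of the $\overline{\genfrac{[}{]}{0pt}{}{x}{i}}$ are in $(-1)^k\mathbb{N}[q^{-1}]$, which means that in fact $\genfrac{[}{]}{0pt}{}{x}{k}\in\mathcal{R}_q^{-}$.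
   Context: Here $q$ and $x$ are commuting indeterminates, $\mathbb{N}=\{0,1,2,\dots\}$, and $\mathbb{N}[q]$, $\mathbb{N}[q^{-1}]$ denote the polynomials in $q$, respectively $q^{-1}$, with coefficients in $\mathbb{N}$. For $n\in\mathbb{Z}$, $[n]_q:=(q^n-1)/(q-1)\in\mathbb{Z}[q,q^{-1}]$; for $n\in\mathbb{N}$, $[n]_q!:=[n]_q\cdots[1]_q$ with $[0]_q!:=1$. For $n\in\mathbb{N}$ and $k\in\mathbb{Z}$, $\genfrac{[}{]}{0pt}{}{n}{k}_q:=\frac{[n]_q!}{[n-k]_q![k]_q!}$ if $0\le k\le n$, and $0$ if $k>n$ or $k<0$. The $q$-binomial coefficient polynomials are $\genfrac{[}{]}{0pt}{}{x}{k}:=\frac{x(x-[1]_q)\cdots(x-[k-1]_q)}{q^{\binom{k}{2}}[k]_q!}$ for $k\ge1$ and $\genfrac{[}{]}{0pt}{}{x}{0}:=1$. The rings are $\mathcal{R}_q^{+}:=\{P\in\mathbb{Q}(q)[x] : P([n]_q)\in\mathbb{Z}[q]\ \forall n\in\mathbb{N}\}$, $\mathcal{R}_q^{-}:=\{P\in\mathbb{Q}(q)[x] : P([-n]_q)\in\mathbb{Z}[q^{-1}]\ \forall n\in\mathbb{N}\}$ and $\mathcal{R}_q:=\{P\in\mathbb{Q}(q)[x] : P([n]_q)\in\mathbb{Z}[q,q^{-1}]\ \forall n\in\mathbb{Z}\}$. The shift operator $S$ is the $\mathbb{Q}(q)$-linear ring automorphism of $\mathbb{Q}(q)[x]$ with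 $S(x)=qx+1$, $S^{-1}(x)=q^{-1}(x-1)$. The bar involution $P\mapsto\overline{P}$ is the ring involution of $\mathbb{Q}(q)[x]$ determined by $\overline{q}=q^{-1}$ (extended to the field involution of $\mathbb{Q}(q)$) and $\overline{x}=-qx$. Both $S$ and the bar involution restrict to $\mathcal{R}_q$. Both $\left\{\genfrac{[}{]}{0pt}{}{x}{k}\right\}_{k\in\mathbb{N}}$ and $\left\{\overline{\genfrac{[}{]}{0pt}{}{x}{k}}\right\}_{k\in\mathbb{N}}$ are $\mathbb{Z}[q,q^{-1}]$-bases of $\mathcal{R}_q$.
   Formalization: The two explicit sum formulas are stated only for k ≥ 1, since at k = 0 the sums are empty (hence 0) while both polynomials equal 1; all other claims are stated for every k in N. *)

theory Defs
  imports
    "HOL-Computational_Algebra.Computational_Algebra"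
    "HOL-Computational_Algebra.Field_as_Ring"
begin

text \<open>
  The field \<open>\<rat>(q)\<close> is the type of fractions of \<open>rat poly\<close>; its generator is \<open>q\<close>.
  The ring \<open>\<rat>(q)[x]\<close> is the type \<open>ratfun poly\<close>, so the polynomial variable is \<open>x\<close>.
\<close>

type_synonym ratfun = "rat poly fract"

definition qvar :: ratfun where
  "qvar = to_fract [:0, 1:]"

text \<open>The subsets \<open>\<int>[t]\<close> and \<open>\<nat>[t]\<close> of \<open>\<rat>(q)\<close>; used for \<open>t = q\<close> and \<open>t = 1 / q\<close>.\<close>

definition int_polys_in :: "ratfun \<Rightarrow> ratfun set" where
  "int_polys_in t = {poly (map_poly of_int p) t | p :: int poly. True}"

definition nat_polys_in :: "ratfun \<Rightarrow> ratfun set" where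
  "nat_polys_in t = {poly (map_poly of_nat p) t | p :: nat poly. True}"

definition laurent_polys :: "ratfun set" where
  "laurent_polys = {f / qvar ^ n | f n. f \<in> int_polys_in qvar}"

definition qint :: "int \<Rightarrow> ratfun" where
  "qint n = (qvar powi n - 1) / (qvar - 1)"

definition qfact :: "nat \<Rightarrow> ratfun" where
  "qfact n = (\<Prod>i=1..n. qint (int i))"

definition qbinomial :: "nat \<Rightarrow> int \<Rightarrow> ratfun" where
  "qbinomial n k =
     (if 0 \<le> k \<and> k \<le> int n then qfact n / (qfact (n - nat k) * qfact (nat k)) else 0)"

text \<open>The first factor of the product is \<open>x - [0]\<^sub>q = x\<close>.\<close>

definition qbinom_poly :: "nat \<Rightarrow> ratfun poly" where
  "qbinom_poly k =
     smult (1 / (qvar ^ (k choose 2) * qfact k)) (\<Prod>i<k. [:- qint (int i), 1:])"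

definition Rq_plus :: "ratfun poly set" where
  "Rq_plus = {P. \<forall>n::nat. poly P (qint (int n)) \<in> int_polys_in qvar}"

definition Rq_minus :: "ratfun poly set" where
  "Rq_minus = {P. \<forall>n::nat. poly P (qint (- int n)) \<in> int_polys_in (inverse qvar)}"

text \<open>
  \<open>expansion b P c\<close>: the finitely supported family \<open>c\<close> with entries in \<open>\<int>[q, 1/q]\<close> expresses
  \<open>P\<close> as a linear combination of the family \<open>b\<close>. When \<open>b\<close> is a \<open>\<int>[q, 1/q]\<close>-basis, \<open>c\<close> is the
  family of coefficients of \<open>P\<close> in \<open>b\<close>.
\<close>

definition expansion :: "(nat \<Rightarrow> ratfun poly) \<Rightarrow> ratfun poly \<Rightarrow> (nat \<Rightarrow> ratfun) \<Rightarrow> bool" where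
  "expansion b P c \<longleftrightarrow>
     finite {i. c i \<noteq> 0} \<and> (\<forall>i. c i \<in> laurent_polys) \<and>
     P = (\<Sum>i | c i \<noteq> 0. smult (c i) (b i))"

definition shift :: "ratfun poly \<Rightarrow> ratfun poly" where
  "shift P = pcompose P [:1, qvar:]"

definition shift_inv :: "ratfun poly \<Rightarrow> ratfun poly" where
  "shift_inv P = pcompose P (smult (inverse qvar) [:-1, 1:])"

definition shift_pow :: "int \<Rightarrow> ratfun poly \<Rightarrow> ratfun poly" where
  "shift_pow m = (if m \<ge> 0 then shift ^^ nat m else shift_inv ^^ nat (- m))"

text \<open>
  \<open>subst_inv p\<close> is \<open>p(1/q)\<close> for \<open>p \<in> \<rat>[q]\<close>. The bar involution on \<open>\<rat>(q)\<close> is computed on the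
  normalized numerator and denominator; \<open>bar_ratfun_Fract\<close> below shows that any other
  representation of the fraction gives the same result.
\<close>

definition subst_inv :: "rat poly \<Rightarrow> ratfun" where
  "subst_inv p = poly (map_poly (\<lambda>c. to_fract [:c:]) p) (inverse qvar)"

definition bar_ratfun :: "ratfun \<Rightarrow> ratfun" where
  "bar_ratfun r = subst_inv (fst (quot_of_fract r)) / subst_inv (snd (quot_of_fract r))"

definition bar :: "ratfun poly \<Rightarrow> ratfun poly" where
  "bar P = pcompose (map_poly bar_ratfun P) [:0, - qvar:]"

lemma qvar_nonzero [simp]: "qvar \<noteq> 0"
  by (simp add: qvar_def)

lemma shift_shift_inv: "shift (shift_inv P) = P"
proof -
  have "pcompose (smult (inverse qvar) [:-1, 1:]) [:1, qvar:] = [:0, 1:]"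
    by (simp add: pcompose_pCons pcompose_smult)
  then show ?thesis
    by (simp add: shift_def shift_inv_def flip: pcompose_assoc)
qed

lemma shift_inv_shift: "shift_inv (shift P) = P"
proof -
  have "pcompose [:1, qvar:] (smult (inverse qvar) [:-1, 1:]) = [:0, 1:]"
    by (simp add: pcompose_pCons)
  then show ?thesis
    by (simp add: shift_def shift_inv_def flip: pcompose_assoc)
qed

lemma const_add: "to_fract [:a + b:] = to_fract [:a:] + to_fract [:b::rat:]"
  by (simp flip: to_fract_add)

lemma const_mult: "to_fract [:a * b:] = to_fract [:a:] * to_fract [:b::rat:]"
  by (simp flip: to_fract_mult)

lemma map_const_add:
  "map_poly (\<lambda>c. to_fract [:c:]) (p + r) =
   map_poly (\<lambda>c. to_fract [:c:]) p + map_poly (\<lambda>c::rat. to_fract [:c:]) r"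
  by (simp add: poly_eq_iff coeff_map_poly const_add)

lemma map_const_mult:
  "map_poly (\<lambda>c. to_fract [:c:]) (p * r) =
   map_poly (\<lambda>c. to_fract [:c:]) p * map_poly (\<lambda>c::rat. to_fract [:c:]) r"
proof (induction p)
  case (pCons a p)
  have "map_poly (\<lambda>c. to_fract [:c:]) (smult a r) =
        smult (to_fract [:a:]) (map_poly (\<lambda>c::rat. to_fract [:c:]) r)"
    by (simp add: poly_eq_iff coeff_map_poly const_mult)
  then show ?case
    using pCons by (simp add: map_const_add map_poly_pCons)
qed simp

lemma subst_inv_add: "subst_inv (p + r) = subst_inv p + subst_inv r"
  by (simp add: subst_inv_def map_const_add)

lemma subst_inv_mult: "subst_inv (p * r) = subst_inv p * subst_inv r"
  by (simp add: subst_inv_def map_const_mult)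

lemma subst_inv_0 [simp]: "subst_inv 0 = 0"
  by (simp add: subst_inv_def)

lemma subst_inv_1 [simp]: "subst_inv 1 = 1"
proof -
  have "to_fract [:1 :: rat:] = 1"
    by (simp only: to_fract_1 flip: one_pCons)
  then show ?thesis
    by (simp add: subst_inv_def)
qed

lemma eval_qvar: "poly (map_poly (\<lambda>c. to_fract [:c:]) p) qvar = to_fract p"
proof (induction p)
  case (pCons a p)
  have "to_fract (pCons a p) = to_fract ([:a:] + [:0, 1:] * p)"
    by simp
  also have "\<dots> = to_fract [:a:] + qvar * to_fract p"
    by (simp only: to_fract_add to_fract_mult qvar_def)
  finally show ?case
    using pCons by (simp add: map_poly_pCons)
qed simp

lemma subst_inv_eq_0_iff [simp]: "subst_inv p = 0 \<longleftrightarrow> p = 0"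
proof
  assume "subst_inv p = 0"
  let ?m = "map_poly (\<lambda>c::rat. to_fract [:c:])"
  have deg: "degree (?m p) = degree p"
    by (rule degree_map_poly) simp
  have "reflect_poly (?m p) = ?m (reflect_poly p)"
    by (simp add: poly_eq_iff coeff_reflect_poly coeff_map_poly deg)
  moreover have "poly (reflect_poly (?m p)) qvar = qvar ^ degree (?m p) * subst_inv p"
    by (simp add: poly_reflect_poly_nz subst_inv_def)
  ultimately have "to_fract (reflect_poly p) = 0"
    using \<open>subst_inv p = 0\<close> by (metis eval_qvar mult_zero_right)
  then show "p = 0"
    by simp
qed simp

lemma bar_ratfun_Fract:
  assumes "b \<noteq> 0"
  shows "bar_ratfun (Fract a b) = subst_inv a / subst_inv b"
proof -
  let ?n = "fst (quot_of_fract (Fract a b))" and ?d = "snd (quot_of_fract (Fract a b))"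
  have "Fract ?n ?d = Fract a b"
    by simp
  then have "?n * b = a * ?d"
    using assms by (subst (asm) eq_fract) auto
  then have "subst_inv ?n * subst_inv b = subst_inv a * subst_inv ?d"
    by (metis subst_inv_mult)
  then show ?thesis
    using assms by (simp add: bar_ratfun_def frac_eq_eq)
qed

lemma bar_ratfun_add: "bar_ratfun (r + s) = bar_ratfun r + bar_ratfun s"
proof (cases r, cases s)
  fix a b c d assume "r = Fract a b" "b \<noteq> 0" "s = Fract c d" "d \<noteq> 0"
  then show ?thesis
    by (simp add: bar_ratfun_Fract subst_inv_add subst_inv_mult add_frac_eq)
qed

lemma bar_ratfun_mult: "bar_ratfun (r * s) = bar_ratfun r * bar_ratfun s"
proof (cases r, cases s)
  fix a b c d assume "r = Fract a b" "b \<noteq> 0" "s = Fract c d" "d \<noteq> 0"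
  then show ?thesis
    by (simp add: bar_ratfun_Fract subst_inv_mult)
qed

lemma bar_ratfun_0 [simp]: "bar_ratfun 0 = 0"
  by (simp add: bar_ratfun_def)

lemma bar_ratfun_1 [simp]: "bar_ratfun 1 = 1"
  by (simp add: bar_ratfun_def)

lemma bar_ratfun_to_fract: "bar_ratfun (to_fract p) = subst_inv p"
  by (simp add: to_fract_def bar_ratfun_Fract)

lemma bar_ratfun_qvar: "bar_ratfun qvar = inverse qvar"
proof -
  have "to_fract [:1 :: rat:] = 1"
    by (simp only: to_fract_1 flip: one_pCons)
  then have "subst_inv [:0, 1:] = inverse qvar"
    by (simp add: subst_inv_def map_poly_pCons)
  then show ?thesis
    by (metis bar_ratfun_to_fract qvar_def)
qed

lemma bar_ratfun_involution: "bar_ratfun (bar_ratfun r) = r"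
proof -
  have divide: "bar_ratfun (a / b) = bar_ratfun a / bar_ratfun b" if "b \<noteq> 0" for a b
  proof -
    have "bar_ratfun (a / b) * bar_ratfun b = bar_ratfun a"
      using that by (simp flip: bar_ratfun_mult)
    moreover have "bar_ratfun b * bar_ratfun (inverse b) = 1"
      using that by (simp flip: bar_ratfun_mult)
    then have "bar_ratfun b \<noteq> 0"
      by auto
    ultimately show ?thesis
      by (simp add: field_simps)
  qed
  have inv: "bar_ratfun (inverse qvar) = qvar"
    using divide[of qvar 1] by (simp add: bar_ratfun_qvar field_simps)
  have *: "bar_ratfun (subst_inv p) = to_fract p" for p
  proof -
    have "bar_ratfun (subst_inv p) = poly (map_poly (\<lambda>c. to_fract [:c:]) p) qvar"
      unfolding subst_inv_def
    proof (induction p)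
      case (pCons a p)
      have "bar_ratfun (to_fract [:a:]) = to_fract [:a:]"
        by (simp add: bar_ratfun_to_fract) (simp add: subst_inv_def map_poly_pCons)
      then show ?case
        using pCons by (simp add: map_poly_pCons bar_ratfun_add bar_ratfun_mult inv)
    qed simp
    then show ?thesis
      by (simp add: eval_qvar)
  qed
  show ?thesis
  proof (cases r)
    case (Fract a b)
    then show ?thesis
      by (simp add: bar_ratfun_Fract divide *) (simp add: Fract_conv_to_fract)
  qed
qed

lemma bar_add: "bar (P + R) = bar P + bar R"
proof -
  have "map_poly bar_ratfun (P + R) = map_poly bar_ratfun P + map_poly bar_ratfun R"
    by (simp add: poly_eq_iff coeff_map_poly bar_ratfun_add)
  then show ?thesis
    by (simp add: bar_def pcompose_add)
qed

lemma bar_mult: "bar (P * R) = bar P * bar R"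
proof -
  have "map_poly bar_ratfun (P * R) = map_poly bar_ratfun P * map_poly bar_ratfun R"
  proof (induction P)
    case (pCons a P)
    have "map_poly bar_ratfun (smult a R) = smult (bar_ratfun a) (map_poly bar_ratfun R)"
      by (rule poly_eqI) (simp only: coeff_map_poly bar_ratfun_0 coeff_smult bar_ratfun_mult)
    moreover have "map_poly bar_ratfun (U + V) = map_poly bar_ratfun U + map_poly bar_ratfun V" for U V
      by (rule poly_eqI) (simp only: coeff_map_poly bar_ratfun_0 coeff_add bar_ratfun_add)
    ultimately show ?case
      by (simp only: map_poly_pCons bar_ratfun_0 mult_pCons_left pCons.IH)
  qed simp
  then show ?thesis
    by (simp add: bar_def pcompose_mult)
qed

lemma bar_const: "bar [:r:] = [:bar_ratfun r:]"
  by (simp add: bar_def map_poly_pCons)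

lemma bar_X: "bar [:0, 1:] = [:0, - qvar:]"
  by (simp add: bar_def map_poly_pCons pcompose_pCons)

lemma bar_involution: "bar (bar P) = P"
proof (induction P)
  case 0
  show ?case by (simp add: bar_def)
next
  case (pCons a P)
  have "bar [:0, - qvar:] = bar ([:- qvar:] * [:0, 1:])"
    by simp
  also have "\<dots> = [:bar_ratfun (- qvar):] * [:0, - qvar:]"
    by (simp only: bar_mult bar_const bar_X)
  also have "bar_ratfun (- qvar) = - inverse qvar"
    using bar_ratfun_add[of qvar "- qvar"] by (simp add: bar_ratfun_qvar eq_neg_iff_add_eq_0 add.commute)
  finally have X: "bar [:0, - qvar:] = [:0, 1:]"
    by simp
  have "pCons a P = [:a:] + [:0, 1:] * P"
    by simp
  then show ?case
    by (simp only: bar_add bar_mult bar_const bar_X bar_ratfun_involution X pCons.IH)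
qed

end

theory Submission
  imports Defs
begin

text \<open>
  Write \<open>[a]\<close> for \<open>qint a\<close>, \<open>b\<^sub>k\<close> for \<open>qbinom_poly k\<close> and \<open>S\<close> for \<open>shift\<close>. Up to a scalar, \<open>b\<^sub>k\<close> is the
  product of the linear factors \<open>x - [i]\<close> with \<open>0 \<le> i < k\<close>. Both operators of the statement permute
  the factors \<open>x - [a]\<close>, \<open>a \<in> \<int>\<close>, up to scalars: \<open>S\<close> takes \<open>x - [a]\<close> to \<open>q (x - [a - 1])\<close>
  (\<open>shift_qlinear\<close>), and the bar involution takes it to \<open>-q (x - [-a])\<close> (\<open>bar_qlinear\<close>). Hence bar
  reflects the roots \<open>[0], \<dots>, [k-1]\<close> of \<open>b\<^sub>k\<close> to \<open>[0], \<dots>, [-(k-1)]\<close>, and \<open>S\<^sup>k\<^sup>-\<^sup>1\<close> translates them to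
  the same set. So bar \<open>b\<^sub>k\<close> and \<open>S\<^sup>k\<^sup>-\<^sup>1 b\<^sub>k\<close> are proportional, and counting powers of \<open>q\<close> gives the
  factor (\<open>bar_qbinom_poly_eq_shift\<close>).

  Exchanging the factor \<open>x - [-1]\<close> for \<open>x - [k]\<close> gives the recurrence
  \<open>S b\<^sub>k\<^sub>+\<^sub>1 = q\<^sup>k\<^sup>+\<^sup>1 b\<^sub>k\<^sub>+\<^sub>1 + b\<^sub>k\<close> (\<open>shift_qbinom_poly_Suc\<close>). Iterating it produces coefficients that
  satisfy the \<open>q\<close>-Pascal rule, so \<open>S\<^sup>m b\<^sub>k\<close> has \<open>q\<close>-binomial coefficients times powers of \<open>q\<close>
  (\<open>funpow_shift_qbinom_poly_sum\<close>); for \<open>m = k - 1\<close> this is the expansion of bar \<open>b\<^sub>k\<close>. The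
  \<open>q\<close>-Pascal rule also shows that these coefficients lie in \<open>\<nat>[q]\<close>, and as \<open>b\<^sub>i\<close> takes the value
  \<open>qbinomial n i\<close> at \<open>[n]\<close>, bar \<open>b\<^sub>k\<close> maps every \<open>[n]\<close> with \<open>n \<ge> 0\<close> into \<open>\<int>[q]\<close>. Coefficients are unique
  because \<open>b\<^sub>i\<close> has degree \<open>i\<close>.

  The statements about the basis of the bar \<open>b\<^sub>i\<close> are the images of these under bar: it
  sends expansions to expansions, \<open>\<nat>[q]\<close> to \<open>\<nat>[1/q]\<close>, and \<open>Rq_plus\<close> into \<open>Rq_minus\<close>.
\<close>

section \<open>Quantum integers and Gaussian binomial coefficients\<close>

lemma qvar_power_neq_1: "n > 0 \<Longrightarrow> qvar ^ n \<noteq> 1"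
proof
  assume n: "n > 0" and "qvar ^ n = 1"
  moreover have "qvar ^ n = to_fract (monom 1 n)"
    by (induction n) (simp_all add: qvar_def monom_Suc monom_0 flip: to_fract_mult one_pCons)
  ultimately have "monom 1 n = (1 :: rat poly)"
    by (metis to_fract_1 to_fract_eq_iff)
  then show False
    using n by (metis degree_1 degree_monom_eq less_irrefl one_neq_zero)
qed

lemma qvar_neq_1 [simp]: "qvar \<noteq> 1"
  using qvar_power_neq_1[of 1] by simp

lemma qint_add: "qint (a + b) = qint a + qvar powi a * qint b"
  by (simp add: qint_def power_int_add algebra_simps flip: add_divide_distrib diff_divide_distrib)

lemma qint_0 [simp]: "qint 0 = 0" and qint_1 [simp]: "qint 1 = 1"
  by (simp_all add: qint_def)

lemma qint_eq_0_iff: "qint (int n) = 0 \<longleftrightarrow> n = 0"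
  using qvar_power_neq_1[of n] by (auto simp: qint_def)

lemma qfact_0 [simp]: "qfact 0 = 1"
  by (simp add: qfact_def)

lemma qfact_Suc: "qfact (Suc n) = qint (int (Suc n)) * qfact n"
  by (simp add: qfact_def mult.commute del: of_nat_Suc)

lemma qfact_nonzero [simp]: "qfact n \<noteq> 0"
  by (simp add: qfact_def qint_eq_0_iff)

lemma qbinomial_0 [simp]: "qbinomial n 0 = 1"
  by (simp add: qbinomial_def)

lemma qbinomial_self [simp]: "qbinomial n (int n) = 1"
  by (simp add: qbinomial_def)

lemma qbinomial_eq_0 [simp]: "n < i \<Longrightarrow> qbinomial n (int i) = 0"
  by (simp add: qbinomial_def)

text \<open>
  This form of the \<open>q\<close>-Pascal rule comes from splitting \<open>[n + 1] = [n - i] + q\<^sup>n\<^sup>-\<^sup>i [i + 1]\<close> in the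
  numerator. The other form, with the power of \<open>q\<close> on the first summand, would not match the
  recurrence for the shift below.
\<close>

lemma qbinomial_Suc_Suc:
  assumes "i \<le> n"
  shows "qbinomial (Suc n) (int (Suc i)) =
         qbinomial n (int (Suc i)) + qvar ^ (n - i) * qbinomial n (int i)"
proof (cases "i = n")
  case True
  then show ?thesis
    using qbinomial_self[of "Suc n"] qbinomial_eq_0[of n "Suc n"] qbinomial_self[of n]
    by (simp del: of_nat_Suc qbinomial_self qbinomial_eq_0)
next
  case False
  define d where "d = n - Suc i"
  have n: "n = Suc (i + d)"
    using assms False by (simp add: d_def)
  have split: "qint (int (Suc n)) = qint (int (Suc d)) + qvar ^ Suc d * qint (int (Suc i))"
    using qint_add[of "int (Suc d)" "int (Suc i)"] by (simp add: n add_ac flip: power_int_of_nat)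
  have nz: "qint (int (Suc d)) \<noteq> 0" "qint (int (Suc i)) \<noteq> 0"
    by (simp_all only: qint_eq_0_iff)
  have top: "qbinomial (Suc n) (int (Suc i)) =
      qint (int (Suc n)) * qfact n / (qint (int (Suc d)) * qfact d * (qint (int (Suc i)) * qfact i))"
    by (simp add: qbinomial_def n qfact_Suc nat_add_distrib del: of_nat_Suc)
  have left: "qbinomial n (int (Suc i)) = qfact n / (qfact d * (qint (int (Suc i)) * qfact i))"
    by (simp add: qbinomial_def n qfact_Suc del: of_nat_Suc)
  have right: "qbinomial n (int i) = qfact n / (qint (int (Suc d)) * qfact d * qfact i)"
    by (simp add: qbinomial_def n qfact_Suc del: of_nat_Suc)
  have ni: "n - i = Suc d"
    by (simp add: n)
  show ?thesis
    unfolding top left right ni split using nz by (simp add: field_simps del: of_nat_Suc)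
qed

section \<open>The bar involution on quantum integers\<close>

lemma bar_ratfun_minus: "bar_ratfun (- r) = - bar_ratfun r"
  using bar_ratfun_add[of r "- r"] by (simp add: eq_neg_iff_add_eq_0 add.commute)

lemma bar_ratfun_diff: "bar_ratfun (r - s) = bar_ratfun r - bar_ratfun s"
  using bar_ratfun_add[of r "- s"] by (simp add: bar_ratfun_minus)

lemma bar_ratfun_inverse: "bar_ratfun (inverse r) = inverse (bar_ratfun r)"
proof (cases "r = 0")
  case False
  then have "bar_ratfun r * bar_ratfun (inverse r) = 1"
    by (simp flip: bar_ratfun_mult)
  then show ?thesis
    by (rule inverse_unique[symmetric])
qed simp

lemma bar_ratfun_divide: "bar_ratfun (r / s) = bar_ratfun r / bar_ratfun s"
  by (simp add: divide_inverse bar_ratfun_mult bar_ratfun_inverse)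

lemma bar_ratfun_power: "bar_ratfun (r ^ n) = bar_ratfun r ^ n"
  by (induction n) (simp_all add: bar_ratfun_mult)

lemma bar_ratfun_power_int: "bar_ratfun (r powi n) = bar_ratfun r powi n"
  by (cases n rule: int_cases4) (simp_all add: power_int_minus bar_ratfun_power bar_ratfun_inverse)

lemma bar_ratfun_eq_0_iff [simp]: "bar_ratfun r = 0 \<longleftrightarrow> r = 0"
  by (metis bar_ratfun_0 bar_ratfun_involution)

lemma bar_ratfun_of_nat: "bar_ratfun (of_nat n) = of_nat n"
  by (induction n) (simp_all add: bar_ratfun_add)

lemma bar_ratfun_of_int: "bar_ratfun (of_int n) = of_int n"
  by (cases n) (simp_all add: bar_ratfun_of_nat bar_ratfun_minus bar_ratfun_diff)

lemma bar_ratfun_qint: "bar_ratfun (qint n) = - qvar * qint (- n)"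
proof -
  have "bar_ratfun (qint n) = (qvar powi (- n) - 1) / (inverse qvar - 1)"
    by (simp add: qint_def bar_ratfun_divide bar_ratfun_diff bar_ratfun_power_int bar_ratfun_qvar
        power_int_minus power_int_inverse)
  also have "inverse qvar - 1 = - (qvar - 1) / qvar"
    by (simp add: field_simps)
  finally show ?thesis
    by (simp add: qint_def field_simps)
qed

lemma bar_ratfun_qint_Suc: "qvar ^ n * bar_ratfun (qint (int (Suc n))) = qint (int (Suc n))"
proof -
  have "0 = qint (int (Suc n)) + qvar powi (int (Suc n)) * qint (- int (Suc n))"
    using qint_add[of "int (Suc n)" "- int (Suc n)"] by simp
  then show ?thesis
    unfolding bar_ratfun_qint power_int_of_nat by (simp add: eq_neg_iff_add_eq_0 mult_ac)
qed

lemma choose_two_Suc: "Suc n choose 2 = (n choose 2) + n"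
  by (simp add: numeral_2_eq_2)

lemma bar_ratfun_qfact: "qvar ^ (n choose 2) * bar_ratfun (qfact n) = qfact n"
proof (induction n)
  case (Suc n)
  have "qvar ^ (Suc n choose 2) * bar_ratfun (qfact (Suc n)) =
        (qvar ^ n * bar_ratfun (qint (int (Suc n)))) * (qvar ^ (n choose 2) * bar_ratfun (qfact n))"
    by (simp add: choose_two_Suc qfact_Suc bar_ratfun_mult power_add mult_ac del: of_nat_Suc)
  then show ?case
    by (simp only: Suc bar_ratfun_qint_Suc qfact_Suc)
qed (simp add: numeral_2_eq_2)

lemma choose_two_add: "(a + b) choose 2 = (a choose 2) + (b choose 2) + a * b"
  by (induction a) (simp_all add: choose_two_Suc numeral_2_eq_2)

text \<open>
  Bar divides \<open>[n]!\<close> by \<open>q\<close> to the power \<open>n choose 2\<close>, so the exponent \<open>i (n - i)\<close> is the excess of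
  \<open>n choose 2\<close> over the contributions of \<open>i\<close> and \<open>n - i\<close>.
\<close>

lemma bar_ratfun_qbinomial:
  assumes "i \<le> n"
  shows "bar_ratfun (qbinomial n (int i)) = qbinomial n (int i) / qvar ^ (i * (n - i))"
proof -
  have qf: "bar_ratfun (qfact m) = qfact m / qvar ^ (m choose 2)" for m
    using bar_ratfun_qfact[of m] by (simp add: field_simps)
  have "n choose 2 = (i choose 2) + ((n - i) choose 2) + i * (n - i)"
    using choose_two_add[of i "n - i"] assms by simp
  then show ?thesis
    using assms by (simp add: qbinomial_def bar_ratfun_divide bar_ratfun_mult qf power_add)
qed

section \<open>Bar and shift on the linear factors\<close>

text \<open>
  The shift translates the index by one and bar negates it, so that acting on a product of such
  factors amounts to reindexing.
\<close>

definition qlinear :: "int \<Rightarrow> ratfun poly" where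
  "qlinear a = [:- qint a, 1:]"

lemma qbinom_poly_qlinear:
  "qbinom_poly k = smult (1 / (qvar ^ (k choose 2) * qfact k)) (\<Prod>i<k. qlinear (int i))"
  by (simp add: qbinom_poly_def qlinear_def)

lemma bar_1 [simp]: "bar 1 = 1"
  using bar_const[of 1] by (simp flip: one_pCons)

lemma bar_smult: "bar (smult r P) = smult (bar_ratfun r) (bar P)"
  using bar_mult[of "[:r:]" P] by (simp add: bar_const)

lemma bar_0 [simp]: "bar 0 = 0"
  by (simp add: bar_def)

lemma bar_sum: "bar (sum f A) = (\<Sum>i\<in>A. bar (f i))"
  by (induction A rule: infinite_finite_induct) (simp_all add: bar_add)

lemma bar_prod: "bar (prod f A) = (\<Prod>i\<in>A. bar (f i))"
  by (induction A rule: infinite_finite_induct) (simp_all add: bar_mult)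

text \<open>
  Since bar sends \<open>x\<close> to \<open>-q x\<close>, evaluating bar \<open>P\<close> at the bar of \<open>y\<close> requires undoing the factor
  \<open>-q\<close>. For \<open>y = [n]\<close> the resulting point is \<open>[-n]\<close>.
\<close>

lemma poly_bar: "poly (bar P) (bar_ratfun y / (- qvar)) = bar_ratfun (poly P y)"
proof -
  have "poly (map_poly bar_ratfun P) (bar_ratfun y) = bar_ratfun (poly P y)"
    by (induction P) (simp_all add: map_poly_pCons bar_ratfun_add bar_ratfun_mult)
  then show ?thesis
    by (simp add: bar_def poly_pcompose)
qed

lemma bar_qlinear: "bar (qlinear a) = smult (- qvar) (qlinear (- a))"
  by (simp add: bar_def map_poly_pCons pcompose_pCons bar_ratfun_minus bar_ratfun_qint qlinear_def)

lemma smult_sum_right: "smult r (sum f A) = (\<Sum>i\<in>A. smult r (f i))"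
  by (induction A rule: infinite_finite_induct) (simp_all add: smult_add_right)

lemma shift_smult: "shift (smult r P) = smult r (shift P)"
  by (simp add: shift_def pcompose_smult)

lemma shift_inv_smult: "shift_inv (smult r P) = smult r (shift_inv P)"
  by (simp add: shift_inv_def pcompose_smult)

lemma shift_sum: "shift (sum f A) = (\<Sum>i\<in>A. shift (f i))"
  by (simp add: shift_def pcompose_sum)

lemma shift_prod: "shift (prod f A) = (\<Prod>i\<in>A. shift (f i))"
  by (simp add: shift_def pcompose_prod)

lemma shift_pow_smult: "shift_pow m (smult r P) = smult r (shift_pow m P)"
proof -
  have "(shift ^^ n) (smult r P) = smult r ((shift ^^ n) P)"
       "(shift_inv ^^ n) (smult r P) = smult r ((shift_inv ^^ n) P)" for n
    by (induction n) (simp_all add: shift_smult shift_inv_smult)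
  then show ?thesis
    by (simp add: shift_pow_def)
qed

lemma shift_pow_uminus: "shift_pow (- m) (shift_pow m P) = P"
proof -
  have "(shift_inv ^^ n) ((shift ^^ n) P) = P" "(shift ^^ n) ((shift_inv ^^ n) P) = P" for n
    by (induction n)
      (simp_all add: funpow_swap1 shift_shift_inv shift_inv_shift,
       simp_all add: shift_shift_inv shift_inv_shift flip: funpow_swap1)
  then show ?thesis
    by (auto simp: shift_pow_def)
qed

lemma shift_qlinear: "shift (qlinear a) = smult qvar (qlinear (a - 1))"
proof -
  have "qint a = 1 + qvar * qint (a - 1)"
    using qint_add[of 1 "a - 1"] by simp
  then show ?thesis
    by (simp add: shift_def pcompose_pCons qlinear_def)
qed

section \<open>The bar of a basis element is a shift\<close>

lemma funpow_shift_qbinom_poly: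
  "(shift ^^ m) (qbinom_poly k) =
   smult (qvar ^ (m * k) / (qvar ^ (k choose 2) * qfact k)) (\<Prod>i<k. qlinear (int i - int m))"
proof (induction m)
  case (Suc m)
  have "(\<Prod>i<k. shift (qlinear (int i - int m))) =
        smult (qvar ^ k) (\<Prod>i<k. qlinear (int i - int (Suc m)))"
    by (simp add: shift_qlinear algebra_simps prod_smult)
  then show ?case
    by (simp add: Suc shift_smult shift_prod power_add mult_ac)
qed (simp add: qbinom_poly_qlinear)

lemma bar_qbinom_poly:
  "bar (qbinom_poly k) =
   smult ((-1) ^ k * qvar ^ (2 * (k choose 2) + k) / qfact k) (\<Prod>i<k. qlinear (- int i))"
proof -
  have "bar_ratfun (qfact k) = qfact k / qvar ^ (k choose 2)"
    using bar_ratfun_qfact[of k] by (metis nonzero_mult_div_cancel_left power_not_zero qvar_nonzero)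
  then have "bar_ratfun (1 / (qvar ^ (k choose 2) * qfact k)) = qvar ^ (2 * (k choose 2)) / qfact k"
    by (simp only: bar_ratfun_divide bar_ratfun_mult bar_ratfun_power bar_ratfun_qvar bar_ratfun_1)
      (simp add: mult_2 power_add divide_simps)
  moreover have "bar (\<Prod>i<k. qlinear (int i)) =
      smult ((-1) ^ k * qvar ^ k) (\<Prod>i<k. qlinear (- int i))"
    by (simp add: bar_prod bar_qlinear prod_smult power_minus[of qvar] del: smult_minus_left)
  ultimately show ?thesis
    by (simp add: qbinom_poly_qlinear bar_smult power_add mult_ac)
qed

text \<open>
  The roots on the two sides are \<open>[-i]\<close> and \<open>[i - (k-1)]\<close> with \<open>0 \<le> i < k\<close>; reversing the order of
  the factors identifies them. The case \<open>k = 0\<close> is separate because there the shift is by \<open>-1\<close>.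
\<close>

lemma bar_qbinom_poly_eq_shift:
  "bar (qbinom_poly k) =
   smult ((-1) ^ k * qvar ^ ((k + 1) choose 2)) (shift_pow (int k - 1) (qbinom_poly k))"
proof (cases k)
  case 0
  then show ?thesis
    by (simp add: qbinom_poly_def shift_pow_def shift_inv_def numeral_2_eq_2 pcompose_1 flip: one_pCons)
next
  case (Suc m)
  have prod: "(\<Prod>i<k. qlinear (int i - int m)) = (\<Prod>i<k. qlinear (- int i))"
    by (rule prod.reindex_bij_witness[of _ "\<lambda>i. m - i" "\<lambda>i. m - i"]) (auto simp: Suc of_nat_diff)
  have "m * k = 2 * (k choose 2)"
    by (simp add: Suc choose_two)
  moreover have "(k + 1) choose 2 = (k choose 2) + k"
    by (simp add: choose_two_Suc)
  ultimately show ?thesis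
    using prod by (simp add: bar_qbinom_poly Suc shift_pow_def funpow_shift_qbinom_poly power_add
        mult_ac del: prod.lessThan_Suc)
qed

section \<open>Expansion of shifted basis elements\<close>

text \<open>
  The shift turns the roots \<open>[0], \<dots>, [k]\<close> into \<open>[-1], \<dots>, [k-1]\<close>, so the two products share all
  factors but one, and \<open>q (x - [-1]) = q (x - [k]) + [k + 1]\<close>.
\<close>

lemma shift_qbinom_poly_Suc:
  "shift (qbinom_poly (Suc k)) = smult (qvar ^ Suc k) (qbinom_poly (Suc k)) + qbinom_poly k"
proof -
  define P where "P = (\<Prod>i<k. qlinear (int i))"
  \<comment> \<open>\<open>r [k + 1]\<close> is the denominator of \<open>b\<^sub>k\<^sub>+\<^sub>1\<close>, and \<open>r / q\<^sup>k\<close> that of \<open>b\<^sub>k\<close>.\<close>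
  define r where "r = qvar ^ ((k choose 2) + k) * qfact k"
  have r: "r \<noteq> 0"
    by (simp add: r_def)
  have n0: "qint (int (Suc k)) \<noteq> 0"
    by (simp only: qint_eq_0_iff)
  have "qint (int (Suc k)) = 1 + qvar * qint (int k)"
    using qint_add[of 1 "int k"] by simp
  then have lin: "smult qvar (qlinear (-1)) = smult qvar (qlinear (int k)) + [:qint (int (Suc k)):]"
    using qint_add[of 1 "-1"] by (simp add: qlinear_def eq_neg_iff_add_eq_0 del: of_nat_Suc)
  have b1: "qbinom_poly (Suc k) = smult (1 / (r * qint (int (Suc k)))) (P * qlinear (int k))"
    by (simp add: qbinom_poly_qlinear P_def r_def choose_two_Suc qfact_Suc mult_ac del: of_nat_Suc)
  have b0: "qbinom_poly k = smult (qvar ^ k / r) P"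
    by (simp add: qbinom_poly_qlinear P_def r_def power_add)
  have "shift (qbinom_poly (Suc k)) =
      smult (qvar ^ Suc k / (r * qint (int (Suc k)))) (\<Prod>i<Suc k. qlinear (int i - 1))"
    using funpow_shift_qbinom_poly[of "Suc 0" "Suc k"]
    by (simp add: r_def choose_two_Suc qfact_Suc mult_ac of_nat_Suc[of 0] del: of_nat_Suc prod.lessThan_Suc)
  also have "(\<Prod>i<Suc k. qlinear (int i - 1)) = P * qlinear (-1)"
    by (simp add: prod.lessThan_Suc_shift P_def mult.commute del: prod.lessThan_Suc)
  also have "smult (qvar ^ Suc k / (r * qint (int (Suc k)))) (P * qlinear (-1)) =
      smult (qvar ^ k / (r * qint (int (Suc k)))) (P * smult qvar (qlinear (-1)))"
    by (simp only: mult_smult_right smult_smult power_Suc) (simp add: mult_ac)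
  also have "\<dots> = smult (qvar ^ Suc k) (qbinom_poly (Suc k)) + qbinom_poly k"
    unfolding lin b0 b1
    using r n0 by (simp only: distrib_left smult_add_right mult_smult_right smult_smult mult.commute[of P]
      mult_pCons_left mult_zero_left pCons_0_0 add_0_right) (simp add: field_simps)
  finally show ?thesis .
qed

text \<open>
  One more shift splits the \<open>i\<close>-th term into \<open>A i\<close>, which keeps \<open>b\<^sub>k\<^sub>-\<^sub>i\<close>, and \<open>B i\<close>, which moves to
  \<open>b\<^sub>k\<^sub>-\<^sub>i\<^sub>-\<^sub>1\<close>. Collecting \<open>A (i + 1)\<close> with \<open>B i\<close> is the \<open>q\<close>-Pascal rule. The bound \<open>m \<le> k\<close> ensures
  that \<open>k - i > 0\<close> for every term that is shifted.
\<close>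

lemma funpow_shift_qbinom_poly_sum:
  assumes "m \<le> k"
  shows "(shift ^^ m) (qbinom_poly k) =
    (\<Sum>i\<le>m. smult (qvar ^ ((m - i) * (k - i)) * qbinomial m (int i)) (qbinom_poly (k - i)))"
  using assms
proof (induction m)
  case (Suc m)
  let ?t = "\<lambda>n i. smult (qvar ^ ((n - i) * (k - i)) * qbinomial n (int i)) (qbinom_poly (k - i))"
  define A where "A = (\<lambda>i. smult (qvar ^ ((Suc m - i) * (k - i)) * qbinomial m (int i)) (qbinom_poly (k - i)))"
  define B where "B = (\<lambda>i. smult (qvar ^ ((m - i) * (k - i)) * qbinomial m (int i)) (qbinom_poly (k - Suc i)))"
  have step: "shift (?t m i) = A i + B i" if "i \<le> m" for i
  proof -
    have "k - i = Suc (k - Suc i)" "Suc m - i = Suc (m - i)"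
      using that Suc.prems by simp_all
    then have "A i = smult (qvar ^ ((m - i) * (k - i)) * qbinomial m (int i))
        (smult (qvar ^ Suc (k - Suc i)) (qbinom_poly (Suc (k - Suc i))))"
      by (simp only: A_def smult_smult mult_Suc power_add) (simp only: mult_ac)
    with \<open>k - i = Suc (k - Suc i)\<close> show ?thesis
      by (simp only: B_def shift_smult shift_qbinom_poly_Suc smult_add_right)
  qed
  have pascal: "A (Suc i) + B i = ?t (Suc m) (Suc i)" if "i \<le> m" for i
  proof -
    have "qvar ^ ((m - i) * (k - i)) = qvar ^ ((m - i) * (k - Suc i)) * qvar ^ (m - i)"
    proof -
      have "k - i = Suc (k - Suc i)"
        using that Suc.prems by simp
      then show ?thesis
        by (simp add: add.commute flip: power_add)
    qed
    then show ?thesis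
      unfolding A_def B_def diff_Suc_Suc qbinomial_Suc_Suc[OF that]
      by (simp only: distrib_left smult_add_left) (simp only: mult_ac)
  qed
  have A0: "A 0 = ?t (Suc m) 0" and A_last: "A (Suc m) = 0"
    using qbinomial_eq_0[of m "Suc m"] by (simp_all add: A_def del: qbinomial_eq_0 of_nat_Suc)
  have "(shift ^^ Suc m) (qbinom_poly k) = (\<Sum>i\<le>m. A i) + (\<Sum>i\<le>m. B i)"
    using Suc by (simp add: shift_sum step sum.distrib)
  also have "(\<Sum>i\<le>m. A i) = (\<Sum>i\<le>Suc m. A i)"
    by (simp add: A_last)
  also have "\<dots> = A 0 + (\<Sum>i\<le>m. A (Suc i))"
    by (rule sum.atMost_Suc_shift)
  also have "\<dots> + (\<Sum>i\<le>m. B i) = ?t (Suc m) 0 + (\<Sum>i\<le>m. ?t (Suc m) (Suc i))"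
    by (simp only: A0 add.assoc flip: sum.distrib) (simp add: pascal del: of_nat_Suc)
  also have "\<dots> = (\<Sum>i\<le>Suc m. ?t (Suc m) i)"
    by (rule sum.atMost_Suc_shift[symmetric])
  finally show ?case .
qed simp

lemma bar_qbinom_poly_Suc_sum:
  "bar (qbinom_poly (Suc m)) =
   smult ((-1) ^ Suc m) (\<Sum>i\<le>m. smult
     (qvar ^ ((Suc (Suc m) choose 2) + (m - i) * (Suc m - i)) * qbinomial m (int i))
     (qbinom_poly (Suc m - i)))"
proof -
  have "bar (qbinom_poly (Suc m)) =
        smult ((-1) ^ Suc m * qvar ^ (Suc (Suc m) choose 2)) ((shift ^^ m) (qbinom_poly (Suc m)))"
    by (simp add: bar_qbinom_poly_eq_shift shift_pow_def)
  also have "\<dots> = smult ((-1) ^ Suc m) (smult (qvar ^ (Suc (Suc m) choose 2))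
       (\<Sum>i\<le>m. smult (qvar ^ ((m - i) * (Suc m - i)) * qbinomial m (int i)) (qbinom_poly (Suc m - i))))"
    by (simp only: funpow_shift_qbinom_poly_sum le_SucI[OF order_refl] smult_smult)
  finally show ?thesis
    by (simp only: smult_sum_right smult_smult power_add mult.assoc)
qed

section \<open>Polynomials and Laurent polynomials in one element\<close>

text \<open>
  Used for the embeddings of \<open>\<nat>\<close> and \<open>\<int>\<close> into \<open>\<rat>(q)\<close>: it makes \<open>nat_polys_in t\<close> and
  \<open>int_polys_in t\<close> closed under sums and products.
\<close>

lemma poly_map_poly_hom:
  fixes f :: "'a::comm_semiring_1 \<Rightarrow> 'b::comm_semiring_1"
  assumes [simp]: "f 0 = 0"
    and add: "\<And>a b. f (a + b) = f a + f b" and mult: "\<And>a b. f (a * b) = f a * f b"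
  shows "poly (map_poly f (p + r)) t = poly (map_poly f p) t + poly (map_poly f r) t"
    and "poly (map_poly f (p * r)) t = poly (map_poly f p) t * poly (map_poly f r) t"
proof -
  have map_add: "map_poly f (u + v) = map_poly f u + map_poly f v" for u v
    by (simp add: poly_eq_iff coeff_map_poly add)
  then show "poly (map_poly f (p + r)) t = poly (map_poly f p) t + poly (map_poly f r) t"
    by simp
  show "poly (map_poly f (p * r)) t = poly (map_poly f p) t * poly (map_poly f r) t"
  proof (induction p)
    case (pCons a p)
    have "map_poly f (smult a r) = smult (f a) (map_poly f r)"
      by (simp add: poly_eq_iff coeff_map_poly mult)
    with pCons show ?case
      by (simp add: map_add map_poly_pCons algebra_simps)
  qed simp
qed

lemma nat_polys_in_add: "a \<in> nat_polys_in t \<Longrightarrow> b \<in> nat_polys_in t \<Longrightarrow> a + b \<in> nat_polys_in t"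
  and nat_polys_in_mult: "a \<in> nat_polys_in t \<Longrightarrow> b \<in> nat_polys_in t \<Longrightarrow> a * b \<in> nat_polys_in t"
  unfolding nat_polys_in_def
  by (auto simp flip: poly_map_poly_hom[where f = of_nat, simplified])

lemma int_polys_in_add: "a \<in> int_polys_in t \<Longrightarrow> b \<in> int_polys_in t \<Longrightarrow> a + b \<in> int_polys_in t"
  and int_polys_in_mult: "a \<in> int_polys_in t \<Longrightarrow> b \<in> int_polys_in t \<Longrightarrow> a * b \<in> int_polys_in t"
  unfolding int_polys_in_def
  by (auto simp flip: poly_map_poly_hom[where f = of_int, simplified])

lemma nat_polys_in_0 [simp]: "0 \<in> nat_polys_in t"
  unfolding nat_polys_in_def by (auto intro!: exI[of _ 0])

lemma nat_polys_in_1 [simp]: "1 \<in> nat_polys_in t"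
  unfolding nat_polys_in_def by (auto intro!: exI[of _ 1])

lemma nat_polys_in_self: "t \<in> nat_polys_in t"
  unfolding nat_polys_in_def by (auto intro!: exI[of _ "[:0, 1:]"] simp: map_poly_pCons)

lemma nat_polys_in_power: "a \<in> nat_polys_in t \<Longrightarrow> a ^ n \<in> nat_polys_in t"
  by (induction n) (simp_all add: nat_polys_in_mult)

lemma nat_polys_in_subset_int_polys_in: "nat_polys_in t \<subseteq> int_polys_in t"
proof -
  have "map_poly of_nat p = (map_poly of_int (map_poly int p) :: ratfun poly)" for p
    by (simp add: poly_eq_iff coeff_map_poly)
  then show ?thesis
    unfolding nat_polys_in_def int_polys_in_def by auto
qed

lemma int_polys_in_minus_1_power: "(-1) ^ n \<in> int_polys_in t"
proof (induction n)
  case 0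
  then show ?case
    using subsetD[OF nat_polys_in_subset_int_polys_in nat_polys_in_1] by simp
next
  case (Suc n)
  have "-1 \<in> int_polys_in t"
    unfolding int_polys_in_def by (auto intro!: exI[of _ "[:-1:]"] simp: map_poly_pCons)
  then show ?case
    using int_polys_in_mult[OF _ Suc] by (simp only: power_Suc)
qed

lemma int_polys_in_signed_nat:
  "c \<in> (\<lambda>a. (-1) ^ k * a) ` nat_polys_in t \<Longrightarrow> c \<in> int_polys_in t"
  using int_polys_in_minus_1_power int_polys_in_mult nat_polys_in_subset_int_polys_in by blast

lemma int_polys_in_sum:
  "(\<And>i. i \<in> A \<Longrightarrow> f i \<in> int_polys_in t) \<Longrightarrow> sum f A \<in> int_polys_in t"
proof (induction A rule: infinite_finite_induct)
  case (insert x A)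
  then show ?case
    by (simp add: int_polys_in_add)
qed (use subsetD[OF nat_polys_in_subset_int_polys_in nat_polys_in_0] in simp_all)

lemma qbinomial_in_nat_polys_in: "qbinomial n (int i) \<in> nat_polys_in qvar"
proof (induction n arbitrary: i)
  case 0
  show ?case
    by (cases i) (simp_all del: of_nat_Suc)
next
  case (Suc n)
  show ?case
  proof (cases i)
    case (Suc j)
    show ?thesis
    proof (cases "j \<le> n")
      case True
      then show ?thesis
        unfolding Suc qbinomial_Suc_Suc[OF True]
        by (intro nat_polys_in_add nat_polys_in_mult nat_polys_in_power nat_polys_in_self Suc.IH)
    qed (simp add: Suc del: of_nat_Suc)
  qed simp
qed

lemma bar_ratfun_image_polys_in:
  shows "a \<in> nat_polys_in t \<Longrightarrow> bar_ratfun a \<in> nat_polys_in (bar_ratfun t)"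
    and "a \<in> int_polys_in t \<Longrightarrow> bar_ratfun a \<in> int_polys_in (bar_ratfun t)"
proof -
  have "bar_ratfun (poly (map_poly of_nat p) t) = poly (map_poly of_nat p) (bar_ratfun t)" for p
    by (induction p) (simp_all add: map_poly_pCons bar_ratfun_add bar_ratfun_mult bar_ratfun_of_nat)
  then show "a \<in> nat_polys_in t \<Longrightarrow> bar_ratfun a \<in> nat_polys_in (bar_ratfun t)"
    unfolding nat_polys_in_def by auto
  have "bar_ratfun (poly (map_poly of_int p) t) = poly (map_poly of_int p) (bar_ratfun t)" for p
    by (induction p) (simp_all add: map_poly_pCons bar_ratfun_add bar_ratfun_mult bar_ratfun_of_int)
  then show "a \<in> int_polys_in t \<Longrightarrow> bar_ratfun a \<in> int_polys_in (bar_ratfun t)"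
    unfolding int_polys_in_def by auto
qed

lemma int_polys_in_subset_laurent_polys: "int_polys_in qvar \<subseteq> laurent_polys"
proof
  fix f assume "f \<in> int_polys_in qvar"
  then have "\<exists>g n. f = g / qvar ^ n \<and> g \<in> int_polys_in qvar"
    by (intro exI[of _ f] exI[of _ 0]) simp
  then show "f \<in> laurent_polys"
    by (simp add: laurent_polys_def)
qed

text \<open>
  Multiplying \<open>f(1/q)\<close> by \<open>q\<close> to the degree of \<open>f\<close> gives the reflected polynomial, which is again
  in \<open>\<int>[q]\<close>.
\<close>

lemma bar_ratfun_laurent_polys:
  assumes "r \<in> laurent_polys"
  shows "bar_ratfun r \<in> laurent_polys"
proof -
  obtain f n where f: "f \<in> int_polys_in qvar" and r: "r = f / qvar ^ n"
    using assms by (auto simp: laurent_polys_def)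
  have "bar_ratfun f \<in> int_polys_in (inverse qvar)"
    using bar_ratfun_image_polys_in(2)[OF f] by (simp add: bar_ratfun_qvar)
  then obtain p where p: "bar_ratfun f = poly (map_poly of_int p) (inverse qvar)"
    by (auto simp: int_polys_in_def)
  let ?m = "map_poly of_int :: int poly \<Rightarrow> ratfun poly"
  have "degree (?m p) = degree p"
    by (rule degree_map_poly) simp
  then have "reflect_poly (?m p) = ?m (reflect_poly p)"
    by (simp add: poly_eq_iff coeff_reflect_poly coeff_map_poly)
  then have "qvar ^ degree (?m p) * bar_ratfun f = poly (?m (reflect_poly p)) qvar"
    using poly_reflect_poly_nz[of qvar "?m p"] p by simp
  then have "bar_ratfun r = poly (?m (reflect_poly p)) qvar * qvar ^ n / qvar ^ degree (?m p)"
    by (simp add: r bar_ratfun_divide bar_ratfun_power bar_ratfun_qvar field_simps)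
  moreover have "poly (?m (reflect_poly p)) qvar * qvar ^ n \<in> int_polys_in qvar"
  proof (rule int_polys_in_mult)
    show "poly (?m (reflect_poly p)) qvar \<in> int_polys_in qvar"
      by (auto simp: int_polys_in_def)
    show "qvar ^ n \<in> int_polys_in qvar"
      using nat_polys_in_power[OF nat_polys_in_self] nat_polys_in_subset_int_polys_in by blast
  qed
  ultimately show ?thesis
    by (auto simp: laurent_polys_def)
qed

section \<open>Existence and uniqueness of the coefficients\<close>

lemma degree_qbinom_poly: "degree (qbinom_poly k) = k"
proof -
  have "degree (\<Prod>i<k. [:- qint (int i), 1:]) = k"
    by (subst degree_prod_eq_sum_degree) auto
  then show ?thesis
    by (simp add: qbinom_poly_def)
qed

lemma qbinom_poly_nonzero: "qbinom_poly k \<noteq> 0"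
  by (simp add: qbinom_poly_def)

text \<open>
  The coefficient of a vanishing combination in the top degree involves only the last member of
  the family.
\<close>

lemma graded_family_independent:
  fixes b :: "nat \<Rightarrow> 'a::idom poly"
  assumes deg: "\<And>i. degree (b i) = i" and nz: "\<And>i. b i \<noteq> 0"
    and sum0: "(\<Sum>i\<le>n. smult (e i) (b i)) = 0"
  shows "i \<le> n \<Longrightarrow> e i = 0"
  using sum0
proof (induction n)
  case 0
  then show ?case
    using nz by simp
next
  case (Suc n)
  have "coeff (\<Sum>i\<le>n. smult (e i) (b i)) (Suc n) = 0"
    by (auto simp: coeff_sum deg intro!: sum.neutral coeff_eq_0)
  then have "e (Suc n) * lead_coeff (b (Suc n)) = 0"
    using arg_cong[OF Suc.prems(2), of "\<lambda>p. coeff p (Suc n)"] by (simp add: deg)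
  then have "e (Suc n) = 0"
    using nz by simp
  with Suc show ?case
    by (auto simp: le_Suc_eq)
qed

lemma expansion_unique:
  assumes deg: "\<And>i. degree (b i) = i" and nz: "\<And>i. b i \<noteq> 0"
    and c: "expansion b P c" and d: "expansion b P d"
  shows "c = d"
proof
  fix j
  have "finite ({i. c i \<noteq> 0} \<union> {i. d i \<noteq> 0} \<union> {j})"
    using c d by (auto simp: expansion_def)
  then obtain n where n: "{i. c i \<noteq> 0} \<union> {i. d i \<noteq> 0} \<union> {j} \<subseteq> {..n}"
    by (meson finite_nat_iff_bounded_le)
  have pad: "P = (\<Sum>i\<le>n. smult (a i) (b i))" if "expansion b P a" "{i. a i \<noteq> 0} \<subseteq> {..n}" for a
  proof -
    have "P = (\<Sum>i | a i \<noteq> 0. smult (a i) (b i))"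
      using that(1) by (simp add: expansion_def)
    also have "\<dots> = (\<Sum>i\<le>n. smult (a i) (b i))"
      using that(2) by (intro sum.mono_neutral_left) auto
    finally show ?thesis .
  qed
  have "P = (\<Sum>i\<le>n. smult (c i) (b i))" "P = (\<Sum>i\<le>n. smult (d i) (b i))"
    using pad[OF c] pad[OF d] n by simp_all
  then have "(\<Sum>i\<le>n. smult (c i - d i) (b i)) = 0"
    by (simp add: smult_diff_left sum_subtractf)
  then show "c j = d j"
    using graded_family_independent[OF deg nz, where e = "\<lambda>i. c i - d i"] n by auto
qed

text \<open>
  The set \<open>A\<close> may be larger than the support of \<open>c\<close>, so an explicit sum can be read as an expansion
  even when it is not known which of its coefficients vanish.
\<close>

lemma expansionI:
  assumes "finite A" "\<And>i. i \<notin> A \<Longrightarrow> c i = 0" "\<And>i. c i \<in> laurent_polys"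
    and "P = (\<Sum>i\<in>A. smult (c i) (b i))"
  shows "expansion b P c"
proof -
  have "{i. c i \<noteq> 0} \<subseteq> A"
    using assms(2) by blast
  then show ?thesis
    unfolding expansion_def using assms
    by (auto intro: finite_subset intro!: sum.mono_neutral_right)
qed

lemma expansion_bar:
  assumes "expansion b P c"
  shows "expansion (\<lambda>i. bar (b i)) (bar P) (\<lambda>i. bar_ratfun (c i))"
  using assms bar_ratfun_laurent_polys
  unfolding expansion_def by (auto simp: bar_sum bar_smult)

text \<open>
  The explicit sum runs over \<open>b\<^sub>k\<^sub>-\<^sub>i\<close> for \<open>i < k\<close>, and here it is indexed by \<open>j = k - i\<close>. For \<open>k = 0\<close>
  that sum is empty, whereas bar \<open>b\<^sub>0 = 1 = b\<^sub>0\<close>.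
\<close>

lemma expansion_bar_qbinom_poly:
  obtains c where "expansion qbinom_poly (bar (qbinom_poly k)) c"
    and "\<And>i. c i \<in> (\<lambda>a. (-1) ^ k * a) ` nat_polys_in qvar"
proof (cases k)
  case 0
  let ?c = "\<lambda>i::nat. if i = 0 then 1 else 0 :: ratfun"
  have mem: "?c i \<in> (\<lambda>a. (-1) ^ k * a) ` nat_polys_in qvar" for i
    by (simp add: 0)
  have "expansion qbinom_poly (bar (qbinom_poly k)) ?c"
  proof (rule expansionI[of "{0}"])
    show "?c i \<in> laurent_polys" for i
      using int_polys_in_signed_nat[OF mem] int_polys_in_subset_laurent_polys by blast
  qed (simp_all add: 0 qbinom_poly_def numeral_2_eq_2 flip: one_pCons)
  then show ?thesis
    using mem by (rule that)
next
  case (Suc m)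
  define a where "a = (\<lambda>i. qvar ^ ((Suc k choose 2) + (m - i) * (k - i)) * qbinomial m (int i))"
  define c where "c = (\<lambda>j. if j \<in> {1..k} then (-1) ^ k * a (k - j) else 0)"
  have "a i \<in> nat_polys_in qvar" for i
    unfolding a_def
    by (intro nat_polys_in_mult nat_polys_in_power nat_polys_in_self qbinomial_in_nat_polys_in)
  then have mem: "c i \<in> (\<lambda>a. (-1) ^ k * a) ` nat_polys_in qvar" for i
    by (auto simp: c_def intro: rev_image_eqI[of 0])
  have "expansion qbinom_poly (bar (qbinom_poly k)) c"
  proof (rule expansionI[of "{1..k}"])
    show "c i \<in> laurent_polys" for i
      using int_polys_in_signed_nat[OF mem] int_polys_in_subset_laurent_polys by blast
    have "bar (qbinom_poly k) = (\<Sum>i\<le>m. smult ((-1) ^ k * a i) (qbinom_poly (k - i)))"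
      unfolding Suc bar_qbinom_poly_Suc_sum a_def by (simp only: smult_sum_right smult_smult)
    also have "\<dots> = (\<Sum>j\<in>{1..k}. smult (c j) (qbinom_poly j))"
      by (rule sum.reindex_bij_witness[of _ "\<lambda>j. k - j" "\<lambda>i. k - i"]) (auto simp: Suc c_def)
    finally show "bar (qbinom_poly k) = (\<Sum>j\<in>{1..k}. smult (c j) (qbinom_poly j))" .
  qed (auto simp: c_def)
  then show ?thesis
    using mem by (rule that)
qed

section \<open>Integrality of values\<close>

text \<open>
  For \<open>k \<le> n\<close> each factor is \<open>[n] - [i] = q\<^sup>i [n - i]\<close>; for \<open>k > n\<close> the factor with \<open>i = n\<close> vanishes.
\<close>

lemma poly_qbinom_poly_qint: "poly (qbinom_poly k) (qint (int n)) = qbinomial n (int k)"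
proof (cases "k \<le> n")
  case True
  then have "(\<Prod>i<k. qint (int n) - qint (int i)) * qfact (n - k) = qvar ^ (k choose 2) * qfact n"
  proof (induction k)
    case (Suc k)
    have nk: "n - k = Suc (n - Suc k)"
      using Suc.prems by simp
    have "qint (int n) - qint (int k) = qvar ^ k * qint (int (n - k))"
      using qint_add[of "int k" "int (n - k)"] Suc.prems by (simp add: of_nat_diff)
    then have "(\<Prod>i<Suc k. qint (int n) - qint (int i)) * qfact (n - Suc k) =
          qvar ^ k * ((\<Prod>i<k. qint (int n) - qint (int i)) * qfact (n - k))"
      unfolding nk by (simp add: qfact_Suc mult_ac del: of_nat_Suc)
    also have "\<dots> = qvar ^ k * (qvar ^ (k choose 2) * qfact n)"
      using Suc by simp
    finally show ?case
      by (simp add: choose_two_Suc power_add mult_ac)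
  qed (simp add: numeral_2_eq_2)
  then show ?thesis
    using True by (simp add: qbinom_poly_def poly_prod qbinomial_def field_simps)
next
  case False
  then have "(\<Prod>i<k. qint (int n) - qint (int i)) = 0"
    by (intro prod_zero) auto
  with False show ?thesis
    by (simp add: qbinom_poly_def poly_prod)
qed

lemma bar_qbinom_poly_in_Rq_plus: "bar (qbinom_poly k) \<in> Rq_plus"
proof -
  obtain c where c: "expansion qbinom_poly (bar (qbinom_poly k)) c"
    and mem: "\<And>i. c i \<in> (\<lambda>a. (-1) ^ k * a) ` nat_polys_in qvar"
    using expansion_bar_qbinom_poly[of k] by blast
  have "poly (bar (qbinom_poly k)) (qint (int n)) =
        (\<Sum>i | c i \<noteq> 0. c i * qbinomial n (int i))" for n
    using c by (simp add: expansion_def poly_sum poly_qbinom_poly_qint)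
  moreover have "c i * qbinomial n (int i) \<in> int_polys_in qvar" for i n
    using qbinomial_in_nat_polys_in nat_polys_in_subset_int_polys_in int_polys_in_signed_nat[OF mem]
    by (intro int_polys_in_mult) auto
  ultimately show ?thesis
    by (simp add: Rq_plus_def int_polys_in_sum)
qed

lemma bar_Rq_plus:
  assumes "P \<in> Rq_plus"
  shows "bar P \<in> Rq_minus"
proof -
  have "poly (bar P) (qint (- int n)) = bar_ratfun (poly P (qint (int n)))" for n
    using poly_bar[of P "qint (int n)"] by (simp add: bar_ratfun_qint)
  then show ?thesis
    using assms bar_ratfun_image_polys_in(2)[of _ qvar]
    by (simp add: Rq_plus_def Rq_minus_def bar_ratfun_qvar)
qed

section \<open>Expansion in the barred basis\<close>

text \<open>
  Apply bar to both sides of the expansion of bar \<open>b\<^sub>m\<^sub>+\<^sub>1\<close>. The exponent arises as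
  \<open>- (m - i) (m + 1 - i) - i (m - i) = (i - m) (m + 1)\<close>, where the second product comes from the bar
  of the \<open>q\<close>-binomial coefficient.
\<close>

lemma qbinom_poly_Suc_sum_bar:
  "qbinom_poly (Suc m) =
   smult ((-1) ^ Suc m) (\<Sum>i\<le>m. smult
     (qvar powi (- int (Suc (Suc m) choose 2) + (int i - int m) * int (Suc m)) * qbinomial m (int i))
     (bar (qbinom_poly (Suc m - i))))"
proof -
  have coeff: "bar_ratfun (qvar ^ ((Suc (Suc m) choose 2) + (m - i) * (Suc m - i)) * qbinomial m (int i)) =
     qvar powi (- int (Suc (Suc m) choose 2) + (int i - int m) * int (Suc m)) * qbinomial m (int i)"
    if "i \<le> m" for i
  proof -
    define N where "N = (Suc (Suc m) choose 2) + (m - i) * (Suc m - i)"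
    have "- int (Suc (Suc m) choose 2) + (int i - int m) * int (Suc m) = - int (N + i * (m - i))"
      using that by (simp add: N_def of_nat_diff Suc_diff_le) (simp add: algebra_simps)
    then have "qvar powi (- int (Suc (Suc m) choose 2) + (int i - int m) * int (Suc m)) =
        inverse (qvar ^ N) / qvar ^ (i * (m - i))"
      by (simp add: power_int_minus power_add divide_inverse del: of_nat_add)
    then show ?thesis
      using that by (simp add: bar_ratfun_mult bar_ratfun_power bar_ratfun_qvar bar_ratfun_qbinomial
          power_inverse flip: N_def)
  qed
  have "qbinom_poly (Suc m) = bar (bar (qbinom_poly (Suc m)))"
    by (simp add: bar_involution)
  also have "\<dots> = smult ((-1) ^ Suc m) (\<Sum>i\<le>m. smult
     (bar_ratfun (qvar ^ ((Suc (Suc m) choose 2) + (m - i) * (Suc m - i)) * qbinomial m (int i)))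
     (bar (qbinom_poly (Suc m - i))))"
    unfolding bar_qbinom_poly_Suc_sum bar_smult bar_sum
    by (simp only: bar_ratfun_power bar_ratfun_minus bar_ratfun_1)
  also have "\<dots> = smult ((-1) ^ Suc m) (\<Sum>i\<le>m. smult
     (qvar powi (- int (Suc (Suc m) choose 2) + (int i - int m) * int (Suc m)) * qbinomial m (int i))
     (bar (qbinom_poly (Suc m - i))))"
    by (intro arg_cong[where f = "smult ((-1) ^ Suc m)"] sum.cong refl) (simp only: coeff atMost_iff)
  finally show ?thesis .
qed

lemma qbinom_poly_eq_shift_bar:
  "qbinom_poly k =
   smult ((-1) ^ k * qvar powi (- int ((k + 1) choose 2)))
     (shift_pow (- (int k - 1)) (bar (qbinom_poly k)))"
proof -
  have "(-1) ^ k * (-1) ^ k = (1 :: ratfun)"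
    by (simp flip: power_mult_distrib)
  then show ?thesis
    unfolding bar_qbinom_poly_eq_shift shift_pow_smult shift_pow_uminus
    by (simp add: power_int_minus mult_ac)
qed

theorem proposition6p3:
  fixes k :: nat
  shows
    "bar (qbinom_poly k) =
       smult ((-1) ^ k * qvar ^ ((k + 1) choose 2)) (shift_pow (int k - 1) (qbinom_poly k))
     \<and> (k \<ge> 1 \<longrightarrow>
          bar (qbinom_poly k) =
          smult ((-1) ^ k)
            (\<Sum>i=0..k-1. smult
               (qvar powi (int ((k + 1) choose 2) + (int k - 1 - int i) * (int k - int i))
                  * qbinomial (k - 1) (int i))
               (qbinom_poly (k - i))))
     \<and> (\<exists>!c. expansion qbinom_poly (bar (qbinom_poly k)) c)
     \<and> (\<forall>c. expansion qbinom_poly (bar (qbinom_poly k)) c \<longrightarrow>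
          (\<forall>i. c i \<in> (\<lambda>a. (-1) ^ k * a) ` nat_polys_in qvar))
     \<and> bar (qbinom_poly k) \<in> Rq_plus
     \<and> qbinom_poly k =
       smult ((-1) ^ k * qvar powi (- int ((k + 1) choose 2)))
         (shift_pow (- (int k - 1)) (bar (qbinom_poly k)))
     \<and> (k \<ge> 1 \<longrightarrow>
          qbinom_poly k =
          smult ((-1) ^ k)
            (\<Sum>i=0..k-1. smult
               (qvar powi (- int ((k + 1) choose 2) + (int i - int k + 1) * int k)
                  * qbinomial (k - 1) (int i))
               (bar (qbinom_poly (k - i)))))
     \<and> (\<exists>!c. expansion (\<lambda>i. bar (qbinom_poly i)) (qbinom_poly k) c)
     \<and> (\<forall>c. expansion (\<lambda>i. bar (qbinom_poly i)) (qbinom_poly k) c \<longrightarrow>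
          (\<forall>i. c i \<in> (\<lambda>a. (-1) ^ k * a) ` nat_polys_in (inverse qvar)))
     \<and> qbinom_poly k \<in> Rq_minus"
proof (intro conjI impI allI)
  show "bar (qbinom_poly k) =
       smult ((-1) ^ k * qvar ^ ((k + 1) choose 2)) (shift_pow (int k - 1) (qbinom_poly k))"
    by (rule bar_qbinom_poly_eq_shift)
  show "qbinom_poly k =
       smult ((-1) ^ k * qvar powi (- int ((k + 1) choose 2)))
         (shift_pow (- (int k - 1)) (bar (qbinom_poly k)))"
    by (rule qbinom_poly_eq_shift_bar)
  show "bar (qbinom_poly k) \<in> Rq_plus"
    by (rule bar_qbinom_poly_in_Rq_plus)
  then show "qbinom_poly k \<in> Rq_minus"
    using bar_Rq_plus bar_involution by metis
  obtain c where c: "expansion qbinom_poly (bar (qbinom_poly k)) c"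
    and mem: "\<And>i. c i \<in> (\<lambda>a. (-1) ^ k * a) ` nat_polys_in qvar"
    using expansion_bar_qbinom_poly[of k] by blast
  have eq_c: "d = c" if "expansion qbinom_poly (bar (qbinom_poly k)) d" for d
    using expansion_unique[OF degree_qbinom_poly qbinom_poly_nonzero that c] .
  show "\<exists>!c. expansion qbinom_poly (bar (qbinom_poly k)) c"
    using c eq_c by blast
  show "d i \<in> (\<lambda>a. (-1) ^ k * a) ` nat_polys_in qvar"
    if "expansion qbinom_poly (bar (qbinom_poly k)) d" for d i
    using eq_c[OF that] mem by simp
  \<comment> \<open>Applying bar to an expansion twice returns it, so existence, uniqueness and positivity all
     carry over to the barred basis.\<close>
  let ?c' = "\<lambda>i. bar_ratfun (c i)"
  have c': "expansion (\<lambda>i. bar (qbinom_poly i)) (qbinom_poly k) ?c'"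
    using expansion_bar[OF c] by (simp add: bar_involution)
  have eq_c': "d = ?c'" if "expansion (\<lambda>i. bar (qbinom_poly i)) (qbinom_poly k) d" for d
  proof -
    have "(\<lambda>i. bar_ratfun (d i)) = c"
      using expansion_bar[OF that] by (intro eq_c) (simp add: bar_involution)
    then show ?thesis
      by (auto simp: bar_ratfun_involution)
  qed
  show "\<exists>!c. expansion (\<lambda>i. bar (qbinom_poly i)) (qbinom_poly k) c"
    using c' eq_c' by blast
  show "d i \<in> (\<lambda>a. (-1) ^ k * a) ` nat_polys_in (inverse qvar)"
    if "expansion (\<lambda>i. bar (qbinom_poly i)) (qbinom_poly k) d" for d i
  proof -
    obtain a where "a \<in> nat_polys_in qvar" "c i = (-1) ^ k * a"
      using mem by blast
    then have "d i = (-1) ^ k * bar_ratfun a" "bar_ratfun a \<in> nat_polys_in (inverse qvar)"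
      using eq_c'[OF that] bar_ratfun_image_polys_in(1)[of a qvar]
      by (simp_all add: bar_ratfun_mult bar_ratfun_power bar_ratfun_minus bar_ratfun_qvar)
    then show ?thesis
      by blast
  qed
next
  assume "k \<ge> 1"
  then obtain m where k: "k = Suc m"
    by (cases k) auto
  have exponent: "int ((k + 1) choose 2) + (int k - 1 - int i) * (int k - int i) =
      int ((Suc (Suc m) choose 2) + (m - i) * (Suc m - i))" if "i \<le> m" for i
    using that by (simp add: k of_nat_diff)
  have "bar (qbinom_poly k) = smult ((-1) ^ k) (\<Sum>i\<le>m. smult
     (qvar ^ ((Suc (Suc m) choose 2) + (m - i) * (Suc m - i)) * qbinomial m (int i))
     (qbinom_poly (Suc m - i)))"
    unfolding k by (rule bar_qbinom_poly_Suc_sum)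
  also have "(\<Sum>i\<le>m. smult
     (qvar ^ ((Suc (Suc m) choose 2) + (m - i) * (Suc m - i)) * qbinomial m (int i))
     (qbinom_poly (Suc m - i))) =
     (\<Sum>i=0..k-1. smult
       (qvar powi (int ((k + 1) choose 2) + (int k - 1 - int i) * (int k - int i))
          * qbinomial (k - 1) (int i))
       (qbinom_poly (k - i)))"
  proof (rule sum.cong)
    fix i assume "i \<in> {0..k-1}"
    then have "i \<le> m"
      by (simp add: k)
    show "smult (qvar ^ ((Suc (Suc m) choose 2) + (m - i) * (Suc m - i)) * qbinomial m (int i))
         (qbinom_poly (Suc m - i)) =
       smult (qvar powi (int ((k + 1) choose 2) + (int k - 1 - int i) * (int k - int i))
          * qbinomial (k - 1) (int i)) (qbinom_poly (k - i))"
      unfolding exponent[OF \<open>i \<le> m\<close>] power_int_of_nat by (simp only: k diff_Suc_1)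
  qed (simp add: k atLeast0AtMost)
  finally show "bar (qbinom_poly k) =
          smult ((-1) ^ k)
            (\<Sum>i=0..k-1. smult
               (qvar powi (int ((k + 1) choose 2) + (int k - 1 - int i) * (int k - int i))
                  * qbinomial (k - 1) (int i))
               (qbinom_poly (k - i)))" .
  have "int i - int (Suc m) + 1 = int i - int m" for i
    by simp
  then show "qbinom_poly k =
          smult ((-1) ^ k)
            (\<Sum>i=0..k-1. smult
               (qvar powi (- int ((k + 1) choose 2) + (int i - int k + 1) * int k)
                  * qbinomial (k - 1) (int i))
               (bar (qbinom_poly (k - i))))"
    unfolding k using qbinom_poly_Suc_sum_bar[of m]
    by (simp only: atLeast0AtMost diff_Suc_1 Suc_eq_plus1[symmetric])
qed

end
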